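(* Let $\mathcal H=\bigcup_{i\ge0}H_i$ be a Level-Prim tree. Then: (a) $\mathcal H$ is a spanning tree of $V$, and along every path in $\mathcal H$ from $r$ to a leaf, the levels of the vertices are non-decreasing; (b) for every $i\ge0$, $\sum_{j\ge i} d(H_j)\le 8\cdot \mathrm{MST}(G/V_{<i})$.
   Context: Let $(V,d)$ be a finite metric with root $r\in V$, and fix $M>0$. Levels: $V_0=\{u: d(r,u)\le M\}$, and for $i\ge1$, $V_i=\{u: 2^{i-1}M<d(r,u)\le 2^iM\}$. A vertex of $V_i$ has level $i$. Write $V_{\le i}=\bigcup_{j\le i}V_j$ and $V_{<i}=V_{\le i-1}$, with $V_{<0}=\emptyset$. Graphs: $G$ is the complete graph on $V$ with edge weights $d$. $G[U]$ is the induced subgraph on $U$. $G/U$ is the multigraph obtained by contracting $U$ to a single vertex, keeping parallel edges; $G/\emptyset=G$. $\mathrm{MST}(\cdot)$ denotes the weight of a minimum spanning tree, and $d(F)$ is the total weight of an edge set $F$. Level-Prim tree: for each $i\ge0$, let $H_i$ be a minimum spanning tree of $G[V_{\le i}]/V_{<i}$, viewed as a set of edges of $G$. Then $\mathcal H=\bigcup_{i\ge0}H_i$. *)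

theory Defs
  imports Complex_Main
begin

text \<open>Finite metric on a vertex set V.\<close>
definition finite_metric :: "'a set \<Rightarrow> ('a \<Rightarrow> 'a \<Rightarrow> real) \<Rightarrow> bool" where
  "finite_metric V d \<longleftrightarrow> finite V \<and>
     (\<forall>x\<in>V. d x x = 0) \<and>
     (\<forall>x\<in>V. \<forall>y\<in>V. x \<noteq> y \<longrightarrow> d x y > 0) \<and>
     (\<forall>x\<in>V. \<forall>y\<in>V. d x y = d y x) \<and>
     (\<forall>x\<in>V. \<forall>y\<in>V. \<forall>z\<in>V. d x z \<le> d x y + d y z)"

text \<open>Level sets V_i, V_{<=i}, V_{<i} and the level of a vertex.\<close>
definition lev :: "'a set \<Rightarrow> ('a \<Rightarrow> 'a \<Rightarrow> real) \<Rightarrow> 'a \<Rightarrow> real \<Rightarrow> nat \<Rightarrow> 'a set" where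
  "lev V d r M i = (if i = 0 then {u \<in> V. d r u \<le> M}
                    else {u \<in> V. 2 ^ (i - 1) * M < d r u \<and> d r u \<le> 2 ^ i * M})"

definition lev_le :: "'a set \<Rightarrow> ('a \<Rightarrow> 'a \<Rightarrow> real) \<Rightarrow> 'a \<Rightarrow> real \<Rightarrow> nat \<Rightarrow> 'a set" where
  "lev_le V d r M i = (\<Union>j\<le>i. lev V d r M j)"

definition lev_lt :: "'a set \<Rightarrow> ('a \<Rightarrow> 'a \<Rightarrow> real) \<Rightarrow> 'a \<Rightarrow> real \<Rightarrow> nat \<Rightarrow> 'a set" where
  "lev_lt V d r M i = (\<Union>j<i. lev V d r M j)"

definition level_of :: "'a set \<Rightarrow> ('a \<Rightarrow> 'a \<Rightarrow> real) \<Rightarrow> 'a \<Rightarrow> real \<Rightarrow> 'a \<Rightarrow> nat" where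
  "level_of V d r M u = (LEAST i. u \<in> lev V d r M i)"

text \<open>Edges of the complete graph on W: 2-element subsets.\<close>
definition edges_on :: "'a set \<Rightarrow> 'a set set" where
  "edges_on W = {{u, v} | u v. u \<in> W \<and> v \<in> W \<and> u \<noteq> v}"

text \<open>Weight of an edge and of an edge set.\<close>
definition ew :: "('a \<Rightarrow> 'a \<Rightarrow> real) \<Rightarrow> 'a set \<Rightarrow> real" where
  "ew d e = (THE w. \<exists>u v. e = {u, v} \<and> w = d u v)"

definition wt :: "('a \<Rightarrow> 'a \<Rightarrow> real) \<Rightarrow> 'a set set \<Rightarrow> real" where
  "wt d F = (\<Sum>e\<in>F. ew d e)"

text \<open>Contraction of U to a single vertex (None); other vertices x become Some x.\<close>
definition contr :: "'a set \<Rightarrow> 'a \<Rightarrow> 'a option" where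
  "contr U x = (if x \<in> U then None else Some x)"

definition contr_link :: "'a set \<Rightarrow> 'a set set \<Rightarrow> ('a option \<times> 'a option) set" where
  "contr_link U F = {(contr U u, contr U v) | u v. {u, v} \<in> F}"

text \<open>F (a set of edges of G) is a spanning tree of the multigraph G[W]/U:
  every edge of F is an edge of G[W] that is not a loop after contraction,
  the image of F connects all vertices of G[W]/U, and F has exactly
  (number of vertices of G[W]/U) - 1 edges (parallel edges counted separately).
  With U = {} this is an ordinary spanning tree of G[W].\<close>
definition spanning_tree_contr :: "'a set \<Rightarrow> 'a set \<Rightarrow> 'a set set \<Rightarrow> bool" where
  "spanning_tree_contr W U F \<longleftrightarrow>
     F \<subseteq> edges_on W \<and> (\<forall>e\<in>F. \<not> e \<subseteq> U) \<and>
     (\<forall>x\<in>W. \<forall>y\<in>W. (contr U x, contr U y) \<in> (contr_link U F)\<^sup>*) \<and>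
     card F + 1 = card (contr U ` W)"

definition is_mst :: "('a \<Rightarrow> 'a \<Rightarrow> real) \<Rightarrow> 'a set \<Rightarrow> 'a set \<Rightarrow> 'a set set \<Rightarrow> bool" where
  "is_mst d W U F \<longleftrightarrow> spanning_tree_contr W U F \<and>
     (\<forall>F'. spanning_tree_contr W U F' \<longrightarrow> wt d F \<le> wt d F')"

text \<open>MST(G[W]/U): minimum weight of a spanning tree.\<close>
definition mst_weight :: "('a \<Rightarrow> 'a \<Rightarrow> real) \<Rightarrow> 'a set \<Rightarrow> 'a set \<Rightarrow> real" where
  "mst_weight d W U = Min (wt d ` {F. spanning_tree_contr W U F})"

text \<open>Simple paths and leaves in an edge set.\<close>
definition is_path :: "'a set set \<Rightarrow> 'a list \<Rightarrow> bool" where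
  "is_path F xs \<longleftrightarrow> xs \<noteq> [] \<and> distinct xs \<and>
     (\<forall>k. Suc k < length xs \<longrightarrow> {xs ! k, xs ! Suc k} \<in> F)"

definition is_leaf :: "'a set set \<Rightarrow> 'a \<Rightarrow> bool" where
  "is_leaf F v \<longleftrightarrow> card {e \<in> F. v \<in> e} = 1"

end

theory Submission
  imports Defs
begin

text \<open>A spanning tree \<open>T\<close> of the contracted graph is doubled to a walk through all vertices. For each
  level \<open>j \<ge> i\<close>, following the walk and connecting every newly met vertex of level \<open>j\<close> either to the
  last vertex of level at most \<open>j\<close> or directly to the root gives a spanning tree competing with
  \<open>H j\<close>. A potential argument bounds its weight by the walk steps whose endpoint has level \<open>j\<close> or
  \<open>j + 1\<close>; each step is thus charged twice, and the total is at most four times the weight of \<open>T\<close>.\<close>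

section \<open>Spanning trees of contracted graphs\<close>

text \<open>The connectivity clause of \<open>spanning_tree_contr\<close> by itself, for edge sets
  that may still contain cycles.\<close>

definition connects :: "'a set \<Rightarrow> 'a set \<Rightarrow> 'a set set \<Rightarrow> bool" where
  "connects W U F \<longleftrightarrow> (\<forall>x\<in>W. \<forall>y\<in>W. (contr U x, contr U y) \<in> (contr_link U F)\<^sup>*)"

lemma contr_linkI: "{u, v} \<in> F \<Longrightarrow> (contr U u, contr U v) \<in> contr_link U F"
  by (auto simp: contr_link_def)

lemma contr_link_mono: "F \<subseteq> F' \<Longrightarrow> contr_link U F \<subseteq> contr_link U F'"
  by (auto simp: contr_link_def)

lemma contr_link_rtrancl_mono:
  "F \<subseteq> F' \<Longrightarrow> (p, q) \<in> (contr_link U F)\<^sup>* \<Longrightarrow> (p, q) \<in> (contr_link U F')\<^sup>*"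
  using rtrancl_mono[OF contr_link_mono] by blast

lemma sym_contr_link: "sym (contr_link U F)"
proof (rule symI)
  fix p q assume "(p, q) \<in> contr_link U F"
  then obtain u v where "p = contr U u" "q = contr U v" "{v, u} \<in> F"
    by (auto simp: contr_link_def insert_commute)
  then show "(q, p) \<in> contr_link U F" by (simp add: contr_linkI)
qed

lemma contr_link_rtrancl_sym: "(p, q) \<in> (contr_link U F)\<^sup>* \<Longrightarrow> (q, p) \<in> (contr_link U F)\<^sup>*"
  using sym_contr_link sym_rtrancl by (metis symD)

lemma contr_eq_iff: "contr U x = contr U y \<longleftrightarrow> x = y \<or> x \<in> U \<and> y \<in> U"
  by (auto simp: contr_def)

lemma connectsI_root:
  assumes "\<And>x. x \<in> W \<Longrightarrow> (contr U x, p) \<in> (contr_link U F)\<^sup>*"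
  shows "connects W U F"
  unfolding connects_def by (meson assms contr_link_rtrancl_sym rtrancl_trans)

lemma finite_edges_on: "finite W \<Longrightarrow> finite (edges_on W)"
  by (rule finite_subset[of _ "Pow W"]) (auto simp: edges_on_def)

lemma edges_on_mono: "W \<subseteq> W' \<Longrightarrow> edges_on W \<subseteq> edges_on W'"
  by (auto simp: edges_on_def)

lemma edges_on_subset: "e \<in> edges_on W \<Longrightarrow> e \<subseteq> W"
  by (auto simp: edges_on_def)

lemma empty_notin_edges_on: "{} \<notin> edges_on W"
  by (auto simp: edges_on_def)

lemma spanning_tree_contr_alt:
  "spanning_tree_contr W U F \<longleftrightarrow>
     F \<subseteq> edges_on W \<and> (\<forall>e\<in>F. \<not> e \<subseteq> U) \<and> connects W U F \<and> card F + 1 = card (contr U ` W)"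
  by (simp add: spanning_tree_contr_def connects_def)

lemma spanning_tree_contr_finite: "spanning_tree_contr W U F \<Longrightarrow> finite W \<Longrightarrow> finite F"
  by (meson spanning_tree_contr_def finite_edges_on finite_subset)

text \<open>Seed of the tree constructions: the side condition makes \<open>insert r U\<close>
  contract to one vertex.\<close>

lemma spanning_tree_contr_single: "spanning_tree_contr (insert r U) U {}" if "U = {} \<or> r \<in> U"
proof -
  have "contr U ` insert r U = {contr U r}"
    using that by (auto simp: contr_def)
  moreover from this have "connects (insert r U) U {}"
    by (intro connectsI_root[where p = "contr U r"]) auto
  ultimately show ?thesis
    by (simp add: spanning_tree_contr_alt del: image_insert)
qed

text \<open>The edge count stays balanced because \<open>b\<close>, outside \<open>W\<close> and
  hence outside \<open>U\<close>, is a new vertex after contraction.\<close>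

lemma spanning_tree_contr_insert:
  assumes st: "spanning_tree_contr W U F" and fin: "finite W" and "U \<subseteq> W" "a \<in> W" "b \<notin> W"
  shows "spanning_tree_contr (insert b W) U (insert {a, b} F)"
proof -
  have F: "F \<subseteq> edges_on W" "\<And>e. e \<in> F \<Longrightarrow> \<not> e \<subseteq> U" "connects W U F" "card F + 1 = card (contr U ` W)"
    using st by (auto simp: spanning_tree_contr_alt)
  have "{a, b} \<notin> F"
    using F(1) edges_on_subset assms(5) by blast
  then have "card (insert {a, b} F) = card F + 1"
    using spanning_tree_contr_finite[OF st fin] by simp
  moreover have "contr U b \<notin> contr U ` W"
    using assms by (auto simp: contr_eq_iff)
  then have "card (contr U ` insert b W) = card (contr U ` W) + 1"
    using fin by simp
  moreover have "{a, b} \<in> edges_on (insert b W)"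
    using assms unfolding edges_on_def by blast
  moreover have "F \<subseteq> edges_on (insert b W)"
    using F(1) edges_on_mono[of W "insert b W"] by blast
  moreover have "connects (insert b W) U (insert {a, b} F)"
  proof (rule connectsI_root)
    fix x assume "x \<in> insert b W"
    then consider "x = b" | "x \<in> W" by blast
    then show "(contr U x, contr U a) \<in> (contr_link U (insert {a, b} F))\<^sup>*"
    proof cases
      case 1
      have "{b, a} \<in> insert {a, b} F" by (auto simp: insert_commute)
      then show ?thesis using 1 contr_linkI r_into_rtrancl by metis
    next
      case 2
      then have "(contr U x, contr U a) \<in> (contr_link U F)\<^sup>*"
        using F(3) assms(4) by (auto simp: connects_def)
      then show ?thesis
        by (rule contr_link_rtrancl_mono[rotated]) blast
    qed
  qed
  ultimately show ?thesis
    using F assms by (auto simp: spanning_tree_contr_alt)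
qed

section \<open>Growing a tree inside a connecting edge set\<close>

lemma connects_crossing_edge:
  assumes "connects W U F" "insert r U \<subseteq> S" "S \<subset> W"
  shows "\<exists>a b. a \<in> S \<and> b \<notin> S \<and> {a, b} \<in> F"
proof (rule ccontr)
  \<comment> \<open>If no edge left \<open>S\<close>, the image of \<open>S\<close> would be closed
    under links, and a vertex outside \<open>S\<close> could not be reached from
    \<open>r\<close>.\<close>
  assume no: "\<not> ?thesis"
  obtain x where x: "x \<in> W" "x \<notin> S" using assms(3) by blast
  have "(contr U r, contr U x) \<in> (contr_link U F)\<^sup>*"
    using assms x by (auto simp: connects_def)
  then have "contr U x \<in> contr U ` S"
  proof (induction rule: rtrancl_induct)
    case base
    show ?case using assms by blast
  next
    case (step p q)
    then obtain u v s where uv: "p = contr U u" "q = contr U v" "{u, v} \<in> F"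
        and s: "s \<in> S" "p = contr U s"
      by (auto simp: contr_link_def)
    \<comment> \<open>Distinct preimages of one contracted vertex lie in \<open>U\<close>, hence in
      \<open>S\<close>.\<close>
    then have "u \<in> S" using assms(2) by (auto simp: contr_eq_iff)
    then have "v \<in> S" using no uv by blast
    then show ?case using uv by blast
  qed
  then show False using x assms(2) by (auto simp: contr_eq_iff)
qed

text \<open>Prim-style growth from the root along crossing edges of \<open>F\<close>, packaged as an
  induction rule so that \<open>P\<close> can carry extra data such as a walk. It selects only a
  part of \<open>F\<close>, which may contain cycles.\<close>

lemma connects_grow_induct [consumes 5, case_names root grow]:
  assumes "connects W U F" "F \<subseteq> edges_on W" "finite W" "insert r U \<subseteq> W" "U = {} \<or> r \<in> U"
    and "P (insert r U) {}"
    and step: "\<And>S E a b. \<lbrakk>P S E; spanning_tree_contr S U E; insert r U \<subseteq> S; S \<subseteq> W; a \<in> S; b \<in> W; b \<notin> S;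
            {a, b} \<in> F; {a, b} \<notin> E; finite E\<rbrakk> \<Longrightarrow> P (insert b S) (insert {a, b} E)"
  shows "\<exists>E\<subseteq>F. spanning_tree_contr W U E \<and> P W E"
proof -
  have "\<exists>E'\<subseteq>F. spanning_tree_contr W U E' \<and> P W E'"
    if "E \<subseteq> F" "spanning_tree_contr S U E" "P S E" "insert r U \<subseteq> S" "S \<subseteq> W" for S E
    using that
  proof (induction "card (W - S)" arbitrary: S E)
    case 0
    then have "S = W" using assms(3) by auto
    then show ?case using 0 by blast
  next
    case (Suc n)
    then have "S \<subset> W" by force
    then obtain a b where ab: "a \<in> S" "b \<notin> S" "{a, b} \<in> F"
      using connects_crossing_edge[OF assms(1)] Suc by metis
    then have b: "b \<in> W" using assms(2) edges_on_subset by blast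
    have finS: "finite S" using \<open>S \<subset> W\<close> assms(3) finite_subset by blast
    have "E \<subseteq> edges_on S" using Suc by (simp add: spanning_tree_contr_def)
    then have E: "{a, b} \<notin> E" "finite E"
      using ab(2) edges_on_subset[of "{a, b}" S] finite_subset[OF _ finite_edges_on[OF finS]] by auto
    have "P (insert b S) (insert {a, b} E)"
      using step[of S E a b] Suc.prems ab b E by blast
    moreover have "spanning_tree_contr (insert b S) U (insert {a, b} E)"
      using spanning_tree_contr_insert[OF Suc.prems(2) finS, of a b] Suc.prems ab by blast
    moreover have "n = card (W - insert b S)"
      using Suc(2) ab b assms(3)
      by (metis DiffI Diff_insert card_Diff_singleton diff_Suc_1)
    ultimately show ?case
      using Suc.hyps(1)[of "insert b S" "insert {a, b} E"] Suc.prems ab b by blast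
  qed
  then show ?thesis
    using spanning_tree_contr_single[OF assms(5)] assms by blast
qed

lemma connects_contains_spanning_tree:
  assumes "connects W U F" "F \<subseteq> edges_on W" "finite W" "insert r U \<subseteq> W" "U = {} \<or> r \<in> U"
  shows "\<exists>E\<subseteq>F. spanning_tree_contr W U E"
  using connects_grow_induct[OF assms, of "\<lambda>_ _. True"] by blast

lemma spanning_tree_contr_exists:
  assumes "finite W" "insert r U \<subseteq> W" "U = {} \<or> r \<in> U"
  shows "\<exists>F. spanning_tree_contr W U F"
proof -
  have "connects W U (edges_on W)"
  proof (rule connectsI_root)
    fix x assume x: "x \<in> W"
    show "(contr U x, contr U r) \<in> (contr_link U (edges_on W))\<^sup>*"
    proof (cases "x = r")
      case False
      then have "{x, r} \<in> edges_on W" using x assms by (auto simp: edges_on_def)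
      then show ?thesis by (blast intro: contr_linkI)
    qed simp
  qed
  then show ?thesis using connects_contains_spanning_tree[OF _ order_refl assms] by blast
qed

text \<open>Acyclicity of spanning trees, by counting: a redundant edge could be removed.\<close>
lemma spanning_tree_contr_no_detour:
  assumes st: "spanning_tree_contr W U F" and fin: "finite W" and "insert r U \<subseteq> W" "U = {} \<or> r \<in> U"
    and e: "{x, y} \<in> F"
  shows "(contr U x, contr U y) \<notin> (contr_link U (F - {{x, y}}))\<^sup>*"
proof
  let ?F = "F - {{x, y}}"
  assume detour: "(contr U x, contr U y) \<in> (contr_link U ?F)\<^sup>*"
  \<comment> \<open>Links through \<open>{x, y}\<close> are rerouted along the detour, so the
    remaining edges still connect \<open>W\<close>.\<close>
  have "contr_link U F \<subseteq> (contr_link U ?F)\<^sup>*"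
  proof clarify
    fix p q assume "(p, q) \<in> contr_link U F"
    then obtain u v where uv: "p = contr U u" "q = contr U v" "{u, v} \<in> F"
      by (auto simp: contr_link_def)
    show "(p, q) \<in> (contr_link U ?F)\<^sup>*"
    proof (cases "{u, v} = {x, y}")
      case True
      then show ?thesis using uv detour contr_link_rtrancl_sym by (metis doubleton_eq_iff)
    next
      case False
      then show ?thesis using uv by (blast intro: contr_linkI)
    qed
  qed
  then have "(contr_link U F)\<^sup>* \<subseteq> (contr_link U ?F)\<^sup>*"
    using rtrancl_subset_rtrancl by blast
  then have "connects W U ?F"
    using st unfolding spanning_tree_contr_alt connects_def by blast
  moreover have "?F \<subseteq> edges_on W" using st by (auto simp: spanning_tree_contr_def)
  ultimately obtain E where E: "E \<subseteq> ?F" "spanning_tree_contr W U E"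
    using connects_contains_spanning_tree assms by metis
  have "E \<subset> F" using E e by blast
  then have "card E < card F"
    using spanning_tree_contr_finite[OF st fin] psubset_card_mono by blast
  then show False using E st by (auto simp: spanning_tree_contr_def)
qed

text \<open>A passage through the contracted vertex expands to a walk inside \<open>U\<close> along
  \<open>F\<close>. The edge counts \<open>card U - 1\<close> and \<open>card (W - U)\<close> add up
  to \<open>card W - 1\<close>; the second one relies on \<open>U\<close> being nonempty, so that
  \<open>None\<close> occurs as a vertex.\<close>

lemma spanning_tree_contr_Un:
  assumes F: "spanning_tree_contr U {} F" and H: "spanning_tree_contr W U H"
    and fin: "finite W" and "U \<subseteq> W" "U \<noteq> {}"
  shows "spanning_tree_contr W {} (F \<union> H)"
proof -
  have finU: "finite U" using assms finite_subset by blast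
  let ?R = "(contr_link {} (F \<union> H))\<^sup>*"
  have fc: "connects U {} F" and hc: "connects W U H"
    using F H by (auto simp: spanning_tree_contr_alt)
  have fR: "(Some x, Some y) \<in> ?R" if "x \<in> U" "y \<in> U" for x y
    using fc that contr_link_rtrancl_mono[of F "F \<union> H"]
    unfolding connects_def contr_def by auto
  \<comment> \<open>The endpoint \<open>y\<close> stays arbitrary in the induction, since
    \<open>None\<close> has every vertex of \<open>U\<close> as a preimage.\<close>
  have lift: "(Some x, Some y) \<in> ?R"
    if "(p, q) \<in> (contr_link U H)\<^sup>*" "p = contr U x" "q = contr U y" for p q x y
    using that(1,3)
  proof (induction arbitrary: y rule: rtrancl_induct)
    case base
    then have "x = y \<or> x \<in> U \<and> y \<in> U" using that(2) by (simp add: contr_eq_iff)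
    then show ?case using fR by auto
  next
    case (step q' q)
    then obtain u v where uv: "q' = contr U u" "q = contr U v" "{u, v} \<in> H"
      by (auto simp: contr_link_def)
    have "(Some x, Some u) \<in> ?R" using step uv by blast
    moreover have "(Some u, Some v) \<in> ?R"
      using contr_linkI[of u v "F \<union> H" "{}"] uv by (auto simp: contr_def)
    moreover have "contr U v = contr U y" using uv step by metis
    then have "v = y \<or> v \<in> U \<and> y \<in> U" by (simp add: contr_eq_iff)
    then have "(Some v, Some y) \<in> ?R" using fR by auto
    ultimately show ?case by (meson rtrancl_trans)
  qed
  have "connects W {} (F \<union> H)"
    using hc lift unfolding connects_def by (simp add: contr_def)
  moreover have "F \<inter> H = {}"
    using F H edges_on_subset[of _ U] unfolding spanning_tree_contr_def disjoint_iff
    by (meson subsetD)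
  then have "card (F \<union> H) = card F + card H"
    using F H fin finU by (simp add: card_Un_disjoint spanning_tree_contr_finite)
  moreover have "card F + 1 = card U"
    using F by (simp add: spanning_tree_contr_def contr_def card_image)
  moreover have "contr U ` W = insert None (Some ` (W - U))"
    using assms by (auto simp: contr_def)
  then have "card H = card (W - U)"
    using H fin by (simp add: spanning_tree_contr_def card_insert_if card_image)
  moreover have "card (W - U) + card U = card W"
    using assms finU by (simp add: card_Diff_subset card_mono)
  moreover have "card (contr {} ` W) = card W"
    by (simp add: contr_def card_image)
  moreover have "F \<union> H \<subseteq> edges_on W"
    using F H edges_on_mono[OF assms(4)] unfolding spanning_tree_contr_def
    by (meson Un_least order_trans)
  moreover from this have "\<forall>e\<in>F \<union> H. \<not> e \<subseteq> {}"
    using empty_notin_edges_on[of W] by (metis subset_empty subsetD)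
  ultimately show ?thesis by (simp add: spanning_tree_contr_alt)
qed

section \<open>Walks\<close>

text \<open>The cost may be asymmetric: free steps and charges both depend on the vertex that a step
  enters.\<close>

fun walk_cost :: "('a \<Rightarrow> 'a \<Rightarrow> real) \<Rightarrow> 'a list \<Rightarrow> real" where
  "walk_cost c (x # y # zs) = c x y + walk_cost c (y # zs)"
| "walk_cost c _ = 0"

lemma walk_cost_append: "walk_cost c (xs @ a # ys) = walk_cost c (xs @ [a]) + walk_cost c (a # ys)"
proof (induction xs)
  case (Cons x xs)
  then show ?case by (cases xs) auto
qed simp

lemma walk_cost_snoc: "xs \<noteq> [] \<Longrightarrow> walk_cost c (xs @ [y]) = walk_cost c xs + c (last xs) y"
  using walk_cost_append[of c "butlast xs" "last xs" "[y]"]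
  by (metis append.assoc append_Cons append_Nil append_butlast_last_id add.right_neutral walk_cost.simps(1,3))

lemma walk_cost_sum: "(\<Sum>j\<in>J. walk_cost (c j) xs) = walk_cost (\<lambda>x y. \<Sum>j\<in>J. c j x y) xs"
  by (induction xs rule: induct_list012) (auto simp: sum.distrib)

lemma walk_cost_mult: "walk_cost (\<lambda>x y. k * c x y) xs = k * walk_cost c xs"
  by (induction xs rule: induct_list012) (auto simp: algebra_simps)

lemma walk_cost_mono:
  assumes "\<And>x y. x \<in> set xs \<Longrightarrow> y \<in> set xs \<Longrightarrow> c x y \<le> c' x y"
  shows "walk_cost c xs \<le> walk_cost c' xs"
  using assms by (induction xs rule: induct_list012) (auto intro!: add_mono)

lemma walk_cost_zero: "(\<And>x y. y \<in> set xs \<Longrightarrow> c x y = 0) \<Longrightarrow> walk_cost c (x # xs) = 0"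
  by (induction xs arbitrary: x) auto

section \<open>Levels\<close>

locale leveled_metric =
  fixes V :: "'a set" and d :: "'a \<Rightarrow> 'a \<Rightarrow> real" and r :: 'a and M :: real
  assumes metric: "finite_metric V d" and root: "r \<in> V" and M_pos: "M > 0"
begin

abbreviation "level \<equiv> level_of V d r M"
abbreviation "Vle \<equiv> lev_le V d r M"
abbreviation "Vlt \<equiv> lev_lt V d r M"

lemma finite_V: "finite V"
  and dist_self: "x \<in> V \<Longrightarrow> d x x = 0"
  and dist_nonneg: "x \<in> V \<Longrightarrow> y \<in> V \<Longrightarrow> d x y \<ge> 0"
  and dist_sym: "x \<in> V \<Longrightarrow> y \<in> V \<Longrightarrow> d x y = d y x"
  and dist_triangle: "x \<in> V \<Longrightarrow> y \<in> V \<Longrightarrow> z \<in> V \<Longrightarrow> d x z \<le> d x y + d y z"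
proof -
  show "x \<in> V \<Longrightarrow> y \<in> V \<Longrightarrow> d x y \<ge> 0"
    using metric unfolding finite_metric_def by (cases "x = y") (auto simp: less_imp_le)
qed (use metric in \<open>auto simp: finite_metric_def\<close>)

text \<open>The radii \<open>2 ^ i * M\<close> increase, so the least \<open>k\<close> whose radius
  reaches \<open>d r u\<close> is the only index of a level set containing \<open>u\<close>.\<close>

lemma level_le_iff:
  assumes "u \<in> V"
  shows "level u \<le> j \<longleftrightarrow> d r u \<le> 2 ^ j * M"
proof -
  obtain n where "d r u / M < 2 ^ n"
    using real_arch_pow[of 2 "d r u / M"] by auto
  then have ex: "d r u \<le> 2 ^ n * M"
    using M_pos by (simp add: field_simps)
  define k where "k = (LEAST k. d r u \<le> 2 ^ k * M)"
  have k: "d r u \<le> 2 ^ k * M" unfolding k_def by (rule LeastI, rule ex)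
  have below: "\<not> d r u \<le> 2 ^ i * M" if "i < k" for i
    using that not_less_Least unfolding k_def by blast
  have above: "d r u \<le> 2 ^ i * M" if "k \<le> i" for i
    using k mult_right_mono[OF power_increasing[OF that, of "2::real"], of M] M_pos by linarith
  have "u \<in> lev V d r M i \<longleftrightarrow> i = k" for i
  proof (cases "i = 0")
    case True
    then have "u \<in> lev V d r M i \<longleftrightarrow> d r u \<le> 2 ^ 0 * M"
      using assms unfolding lev_def by simp
    then show ?thesis using below[of 0] above[of 0] True by auto
  next
    case False
    then have "u \<in> lev V d r M i \<longleftrightarrow> \<not> d r u \<le> 2 ^ (i - 1) * M \<and> d r u \<le> 2 ^ i * M"
      using assms unfolding lev_def by auto
    also have "\<dots> \<longleftrightarrow> \<not> k \<le> i - 1 \<and> k \<le> i"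
      using below above not_le by blast
    finally show ?thesis using False by auto
  qed
  then have "level u = k" unfolding level_of_def by (simp add: Least_equality)
  then show ?thesis using below above not_le by blast
qed

lemma lev_eq: "lev V d r M j = {u \<in> V. level u = j}"
proof (cases j)
  case 0
  then show ?thesis using level_le_iff[of _ 0] unfolding lev_def by auto
next
  case (Suc i)
  have "u \<in> lev V d r M j \<longleftrightarrow> u \<in> V \<and> level u = j" for u
    using level_le_iff[of u i] level_le_iff[of u j] Suc unfolding lev_def by auto
  then show ?thesis by blast
qed

lemma Vle_eq: "Vle j = {u \<in> V. level u \<le> j}"
  by (auto simp: lev_le_def lev_eq)

lemma Vlt_eq: "Vlt j = {u \<in> V. level u < j}"
  by (auto simp: lev_lt_def lev_eq)

lemma Vlt_Suc: "Vlt (Suc j) = Vle j"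
  by (auto simp: Vlt_eq Vle_eq)

lemma level_root: "level r = 0"
  using level_le_iff[OF root, of 0] M_pos dist_self[OF root] by simp

text \<open>Supplies the side condition of the growth lemmas; only at level 0 is nothing
  contracted.\<close>

lemma root_Vlt: "Vlt j = {} \<or> r \<in> Vlt j"
  by (cases j) (auto simp: Vlt_eq level_root root)

lemma root_Vle: "r \<in> Vle j"
  by (simp add: Vle_eq level_root root)

lemma finite_Vle: "finite (Vle j)"
  using finite_V by (simp add: Vle_eq)

lemma Vlt_subset_Vle: "insert r (Vlt j) \<subseteq> Vle j"
  using root_Vle by (auto simp: Vlt_eq Vle_eq)

section \<open>Edge weights and the doubled walk\<close>

lemma ew_eq: "u \<in> V \<Longrightarrow> v \<in> V \<Longrightarrow> ew d {u, v} = d u v"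
  unfolding ew_def by (rule the_equality) (auto simp: doubleton_eq_iff dist_sym)

lemma ew_nonneg: "e \<in> edges_on V \<Longrightarrow> ew d e \<ge> 0"
  by (auto simp: edges_on_def ew_eq dist_nonneg)

lemma wt_mono: "E \<subseteq> F \<Longrightarrow> F \<subseteq> edges_on V \<Longrightarrow> wt d E \<le> wt d F"
  unfolding wt_def
  by (rule sum_mono2) (use finite_edges_on[OF finite_V] finite_subset ew_nonneg in blast)+

lemma wt_insert:
  "u \<in> V \<Longrightarrow> v \<in> V \<Longrightarrow> finite F \<Longrightarrow> {u, v} \<notin> F \<Longrightarrow> wt d (insert {u, v} F) = d u v + wt d F"
  by (simp add: wt_def ew_eq)

text \<open>Doubling a tree. Steps into the contracted set are free, since its vertices are identified.\<close>
lemma walk_of_spanning_tree: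
  assumes T: "spanning_tree_contr V U T" and U: "U \<subseteq> V" "U = {} \<or> r \<in> U"
  obtains xs where "xs \<noteq> []" "hd xs = r" "set xs = V"
    "walk_cost (\<lambda>x y. if y \<in> U then 0 else d x y) xs \<le> 2 * wt d T"
proof -
  define c where "c = (\<lambda>x y. if y \<in> U then 0 else d x y)"
  have T': "connects V U T" "T \<subseteq> edges_on V" "insert r U \<subseteq> V"
    using T U root by (auto simp: spanning_tree_contr_alt)
  have "\<exists>E\<subseteq>T. spanning_tree_contr V U E \<and>
      (\<exists>xs. xs \<noteq> [] \<and> hd xs = r \<and> set xs = V \<and> walk_cost c xs \<le> 2 * wt d E)"
    using T'(1,2) finite_V T'(3) U(2)
  proof (induction rule: connects_grow_induct)
    case root
    \<comment> \<open>All of \<open>U\<close> is visited right after the root, since steps into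
      \<open>U\<close> cost nothing.\<close>
    obtain ys where ys: "set ys = U" using finite_list finite_V U finite_subset by metis
    then have "walk_cost c (r # ys) = 0" by (intro walk_cost_zero) (auto simp: c_def)
    then show ?case using ys by (intro exI[of _ "r # ys"]) (auto simp: wt_def)
  next
    case (grow S E a b)
    then obtain xs where xs: "xs \<noteq> []" "hd xs = r" "set xs = S" "walk_cost c xs \<le> 2 * wt d E"
      by blast
    \<comment> \<open>The round trip \<open>a\<close>, \<open>b\<close>, \<open>a\<close> is
      inserted at an occurrence of \<open>a\<close>; it costs at most twice the new edge.\<close>
    obtain ys zs where xs_eq: "xs = ys @ a # zs"
      using grow xs by (metis split_list)
    have aV: "a \<in> V" "b \<in> V" using grow by auto
    have "walk_cost c (ys @ a # b # a # zs) = walk_cost c xs + c a b + c b a"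
      unfolding xs_eq walk_cost_append[of c ys a "b # a # zs"] walk_cost_append[of c ys a zs] by simp
    also have "\<dots> \<le> 2 * wt d (insert {a, b} E)"
      using xs(4) dist_sym[OF aV] dist_nonneg[OF aV] wt_insert[OF aV] grow by (auto simp: c_def)
    finally show ?case
      using xs xs_eq by (intro exI[of _ "ys @ a # b # a # zs"]) (auto simp: hd_append)
  qed
  then obtain E xs where "E \<subseteq> T" "xs \<noteq> []" "hd xs = r" "set xs = V" "walk_cost c xs \<le> 2 * wt d E"
    by blast
  then show thesis
    using that[of xs] wt_mono[of E T] T'(2) unfolding c_def by linarith
qed

section \<open>Potential and charges along a walk\<close>

text \<open>While the walk moves above level \<open>j\<close>, the potential bounds from below what has already been
  paid for the next connection: \<open>a\<close> is the last tree vertex met, and a walk that has climbed to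
  radius \<open>2 ^ (j + 1) * M\<close> pays enough on its way down for a direct edge to the root.\<close>
definition potential :: "nat \<Rightarrow> 'a \<Rightarrow> 'a \<Rightarrow> real" where
  "potential j a y = max 0 (min (d a y) (2 ^ (j + 1) * M - d r y))"

text \<open>Two levels suffice: beyond level \<open>j + 1\<close> the radius exceeds
  \<open>2 ^ (j + 1) * M\<close>, where the potential vanishes.\<close>

definition charge :: "nat \<Rightarrow> 'a \<Rightarrow> 'a \<Rightarrow> real" where
  "charge j x y = (if level y = j \<or> level y = j + 1 then d x y else 0)"

lemma potential_nonneg: "potential j a y \<ge> 0"
  by (simp add: potential_def)

lemma potential_self: "y \<in> V \<Longrightarrow> potential j y y = 0"
  by (simp add: potential_def dist_self)

text \<open>A step from \<open>x\<close> to \<open>y\<close> changes both the distance to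
  \<open>a\<close> and the radius by at most \<open>d x y\<close>, so the potential grows by at most
  that much; past level \<open>j + 1\<close> it is zero.\<close>

lemma potential_step:
  assumes V: "a \<in> V" "x \<in> V" "y \<in> V" and lev: "j \<le> level y"
  shows "potential j a y \<le> potential j a x + charge j x y"
proof (cases "level y \<le> j + 1")
  case True
  then have "charge j x y = d x y" using lev by (auto simp: charge_def)
  then show ?thesis
    using dist_triangle[of a x y] dist_triangle[of r y x] dist_sym[of x y] dist_nonneg[of x y] V root
    unfolding potential_def by auto
next
  case False
  then have "d r y > 2 ^ (j + 1) * M" using level_le_iff V by force
  then have "potential j a y = 0" by (simp add: potential_def)
  moreover have "charge j x y = 0" using False by (simp add: charge_def)
  ultimately show ?thesis using potential_nonneg by simp
qed

lemma charge_nonneg: "x \<in> V \<Longrightarrow> y \<in> V \<Longrightarrow> charge j x y \<ge> 0"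
  by (simp add: charge_def dist_nonneg)

text \<open>Only \<open>j = level y\<close> and \<open>j = level y - 1\<close> charge a step into
  \<open>y\<close>; if \<open>level y < i\<close>, neither lies in the range.\<close>

lemma sum_charge_le:
  assumes "x \<in> V" "y \<in> V"
  shows "(\<Sum>j\<in>{i..n}. charge j x y) \<le> 2 * (if y \<in> Vlt i then 0 else d x y)"
proof (cases "y \<in> Vlt i")
  case True
  then show ?thesis by (auto simp: Vlt_eq charge_def intro!: sum_nonpos)
next
  case False
  \<comment> \<open>For \<open>level y = 0\<close> truncated subtraction counts index 0 twice, which
    only enlarges the bound.\<close>
  have "(\<Sum>j\<in>{i..n}. charge j x y)
      \<le> (\<Sum>j\<in>{i..n}. (if j = level y then d x y else 0) + (if j = level y - 1 then d x y else 0))"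
    using dist_nonneg[OF assms] by (intro sum_mono) (auto simp: charge_def)
  also have "\<dots> \<le> d x y + d x y"
    unfolding sum.distrib using dist_nonneg[OF assms] by (intro add_mono) auto
  finally show ?thesis using False by simp
qed

text \<open>Invariant along prefixes of the walk: after the tree built so far is paid for, the
  remaining charges cover the potential of the current vertex relative to an anchor \<open>a\<close>
  in the tree.\<close>

lemma walk_level_tree:
  assumes "xs \<noteq> []" "hd xs = r" "set xs \<subseteq> V"
  shows "\<exists>F a. spanning_tree_contr (insert r (Vlt j) \<union> (set xs \<inter> Vle j)) (Vlt j) F \<and>
     a \<in> insert r (Vlt j) \<union> (set xs \<inter> Vle j) \<and>
     wt d F + potential j a (last xs) \<le> walk_cost (charge j) xs"
  using assms
proof (induction xs rule: rev_nonempty_induct)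
  case (single x)
  have "insert r (Vlt j) \<union> (set [x] \<inter> Vle j) = insert r (Vlt j)"
    using single by auto
  then show ?case
    using single spanning_tree_contr_single[OF root_Vlt] root
    by (intro exI[of _ "{}"] exI[of _ r]) (auto simp: wt_def potential_self)
next
  case (snoc y xs)
  define W where "W = insert r (Vlt j) \<union> (set xs \<inter> Vle j)"
  define W' where "W' = insert r (Vlt j) \<union> (set (xs @ [y]) \<inter> Vle j)"
  obtain F a where F: "spanning_tree_contr W (Vlt j) F" and a: "a \<in> W"
    and le: "wt d F + potential j a (last xs) \<le> walk_cost (charge j) xs"
    using snoc unfolding W_def by auto
  have WV: "W \<subseteq> Vle j" "W \<subseteq> V"
    using Vlt_subset_Vle unfolding W_def by (auto simp: Vle_eq root)
  have V: "last xs \<in> V" "y \<in> V" "a \<in> V"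
    using snoc a WV by (auto dest: last_in_set)
  have cost: "walk_cost (charge j) (xs @ [y]) = walk_cost (charge j) xs + charge j (last xs) y"
    using snoc by (simp add: walk_cost_snoc)
  have "\<exists>F a. spanning_tree_contr W' (Vlt j) F \<and> a \<in> W' \<and>
     wt d F + potential j a y \<le> walk_cost (charge j) (xs @ [y])"
  proof -
    consider "y \<in> W" | "y \<notin> W" "y \<notin> Vle j" | "y \<notin> W" "y \<in> Vle j" by blast
    then show ?thesis
    proof cases
      \<comment> \<open>Back in the tree: the anchor moves to \<open>y\<close>, and the saved
        potential is given up.\<close>
      case 1
      then have "W' = W" unfolding W'_def W_def by auto
      then show ?thesis
        using 1 F le cost potential_self[OF V(2)] potential_nonneg[of j a "last xs"]
          charge_nonneg[OF V(1,2), of j]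
        by (intro exI[of _ F] exI[of _ y]) auto
    next
      \<comment> \<open>Above level \<open>j\<close> the tree and the anchor stay fixed; the charge
        pays for the change of potential.\<close>
      case 2
      then have "W' = W" unfolding W'_def W_def by auto
      moreover have "j \<le> level y" using 2 V by (auto simp: Vle_eq)
      ultimately show ?thesis
        using F a le cost potential_step[OF V(3,1,2), of j] by (intro exI[of _ F] exI[of _ a]) auto
    next
      case 3
      have W': "W' = insert y W" using 3 unfolding W'_def W_def by auto
      have lev: "level y = j" using 3 V unfolding W_def by (auto simp: Vle_eq Vlt_eq)
      \<comment> \<open>At level \<open>j\<close> the slack \<open>2 ^ (j + 1) * M - d r y\<close>
        is at least \<open>d r y\<close>. The potential therefore pays for the cheaper of the edges
        from \<open>a\<close> and from the root.\<close>
      have "d r y \<le> 2 ^ j * M" using level_le_iff[OF V(2), of j] lev by simp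
      then have "min (d a y) (d r y) \<le> potential j a y" unfolding potential_def by simp
      then obtain b where b: "b \<in> W" "d b y \<le> potential j a y"
        using a unfolding W_def by (cases "d a y \<le> d r y") auto
      have finW: "finite W" using WV finite_Vle finite_subset by blast
      have tree: "spanning_tree_contr W' (Vlt j) (insert {b, y} F)"
        unfolding W' using F finW b 3 by (intro spanning_tree_contr_insert) (auto simp: W_def)
      have "{b, y} \<notin> F" using F 3 edges_on_subset unfolding spanning_tree_contr_def by blast
      then have "wt d (insert {b, y} F) = d b y + wt d F"
        using b WV V spanning_tree_contr_finite[OF F finW] by (intro wt_insert) auto
      then show ?thesis
        using tree W' b le cost potential_step[OF V(3,1,2), of j] potential_self[OF V(2)] lev
        by (intro exI[of _ "insert {b, y} F"] exI[of _ y]) auto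
    qed
  qed
  then show ?case unfolding W'_def by simp
qed

end

section \<open>Level-Prim trees\<close>

locale level_prim = leveled_metric +
  fixes H :: "nat \<Rightarrow> 'a set set"
  assumes mst: "\<And>i. is_mst d (lev_le V d r M i) (lev_lt V d r M i) (H i)"
begin

lemma H_tree: "spanning_tree_contr (Vle i) (Vlt i) (H i)"
  using mst by (simp add: is_mst_def)

lemma wt_H_le: "spanning_tree_contr (Vle i) (Vlt i) F \<Longrightarrow> wt d (H i) \<le> wt d F"
  using mst by (simp add: is_mst_def)

text \<open>An edge of \<open>H k\<close> lies in \<open>Vle k\<close> but not in
  \<open>Vlt k\<close>, so its higher endpoint reveals \<open>k\<close>.\<close>

lemma prim_edge_iff: "{x, y} \<in> (\<Union>i. H i) \<longleftrightarrow> {x, y} \<in> H (max (level x) (level y))"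
proof
  assume "{x, y} \<in> (\<Union>i. H i)"
  then obtain k where k: "{x, y} \<in> H k" by blast
  then have "{x, y} \<subseteq> Vle k" "\<not> {x, y} \<subseteq> Vlt k"
    using H_tree[of k] edges_on_subset unfolding spanning_tree_contr_def by blast+
  then have "max (level x) (level y) = k" by (auto simp: Vle_eq Vlt_eq)
  then show "{x, y} \<in> H (max (level x) (level y))" using k by simp
qed blast

text \<open>Levels are glued one by one: the prefix tree spans exactly the set contracted at the
  next level.\<close>

lemma prim_prefix_tree: "spanning_tree_contr (Vle n) {} (\<Union>i\<le>n. H i)"
proof (induction n)
  case 0
  have "Vlt 0 = {}" by (simp add: Vlt_eq)
  then show ?case using H_tree[of 0] by simp
next
  case (Suc n)
  have "H (Suc n) \<union> (\<Union>i\<le>n. H i) = (\<Union>i\<le>Suc n. H i)"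
    by (simp add: atMost_Suc)
  moreover have "spanning_tree_contr (Vle (Suc n)) {} ((\<Union>i\<le>n. H i) \<union> H (Suc n))"
    using Suc H_tree[of "Suc n"] finite_Vle root_Vle Vlt_subset_Vle[of "Suc n"] unfolding Vlt_Suc
    by (intro spanning_tree_contr_Un) auto
  ultimately show ?case by (simp add: Un_commute)
qed

lemma prim_spanning_tree: "spanning_tree_contr V {} (\<Union>i. H i)"
proof -
  define n where "n = Max (level ` V)"
  have n: "level u \<le> n" if "u \<in> V" for u
    unfolding n_def using finite_V that by simp
  then have Vn: "Vle n = V" by (auto simp: Vle_eq)
  \<comment> \<open>Above the maximal level everything is contracted, so any edge would be a
    loop.\<close>
  have "H i = {}" if "n < i" for i
  proof -
    have "Vle i \<subseteq> Vlt i" using n that by (auto simp: Vle_eq Vlt_eq dest: le_less_trans)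
    moreover have "e \<subseteq> Vle i \<and> \<not> e \<subseteq> Vlt i" if "e \<in> H i" for e
      using H_tree[of i] that edges_on_subset[of e "Vle i"] unfolding spanning_tree_contr_def by auto
    ultimately show ?thesis by (metis equals0I order_trans)
  qed
  then have "H i \<subseteq> (\<Union>i\<le>n. H i)" for i
    by (cases "i \<le> n") auto
  then have "(\<Union>i. H i) = (\<Union>i\<le>n. H i)" by blast
  then show ?thesis using prim_prefix_tree[of n] Vn by simp
qed

text \<open>A descent from level \<open>j\<close> would close a cycle in the contracted graph of level \<open>j\<close>,
  through the contracted vertex.\<close>
lemma prim_path_levels:
  assumes path: "is_path (\<Union>i. H i) xs" "hd xs = r" and "k < length xs"
  shows "sorted (map level (take (Suc k) xs)) \<and>
    (level (xs ! k) = 0 \<or>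
     (contr (Vlt (level (xs ! k))) (xs ! k), None) \<in> (contr_link (Vlt (level (xs ! k)))
        (H (level (xs ! k)) \<inter> {e. e \<subseteq> set (take (Suc k) xs)}))\<^sup>*)"
  \<comment> \<open>The second conjunct strengthens the induction: the visited part of the path
    links its end to the contracted vertex using edges of the end's own level. Level 0 is exempt,
    having no contracted vertex.\<close>
  using assms(3)
proof (induction k)
  case 0
  then have "xs ! 0 = r" using path by (simp add: is_path_def hd_conv_nth)
  then show ?case using 0 level_root by (simp add: take_Suc_conv_app_nth)
next
  case (Suc k)
  let ?x = "xs ! k" and ?y = "xs ! Suc k"
  let ?P = "\<lambda>k. {e. e \<subseteq> set (take (Suc k) xs)}"
  have IH: "sorted (map level (take (Suc k) xs))"
    "level ?x = 0 \<or> (contr (Vlt (level ?x)) ?x, None) \<in> (contr_link (Vlt (level ?x)) (H (level ?x) \<inter> ?P k))\<^sup>*"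
    using Suc by simp_all
  have tk: "take (Suc (Suc k)) xs = take (Suc k) xs @ [?y]" "take (Suc k) xs = take k xs @ [?x]"
    using Suc by (simp_all add: take_Suc_conv_app_nth)
  have yn: "?y \<notin> set (take (Suc k) xs)"
    using path(1) Suc tk by (metis is_path_def distinct_take distinct_append not_distinct_conv_prefix
        disjoint_insert(1) list.set(2))
  have edge: "{?x, ?y} \<in> H (max (level ?x) (level ?y))"
    using path(1) Suc prim_edge_iff unfolding is_path_def by blast
  have V: "?x \<in> V" "?y \<in> V"
    using edge H_tree edges_on_subset[of "{?x, ?y}"] unfolding spanning_tree_contr_def
    by (fastforce simp: Vle_eq)+
  have asc: "level ?x \<le> level ?y"
  proof (rule ccontr)
    assume "\<not> ?thesis"
    \<comment> \<open>Now \<open>?y\<close> belongs to the contracted set, so the edge links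
      \<open>?x\<close> to \<open>None\<close>. The visited part already does so without this edge,
      because \<open>?y\<close> is new on the path.\<close>
    then have lt: "level ?y < level ?x" by simp
    let ?U = "Vlt (level ?x)" and ?F = "H (level ?x)"
    have e: "{?x, ?y} \<in> ?F" using edge lt by (simp add: max_def)
    have "?F \<inter> ?P k \<subseteq> ?F - {{?x, ?y}}" using yn by auto
    moreover have "(contr ?U ?x, None) \<in> (contr_link ?U (?F \<inter> ?P k))\<^sup>*"
      using IH(2) lt by linarith
    ultimately have "(contr ?U ?x, None) \<in> (contr_link ?U (?F - {{?x, ?y}}))\<^sup>*"
      using contr_link_rtrancl_mono by metis
    moreover have "contr ?U ?y = None" using lt V by (simp add: contr_def Vlt_eq)
    ultimately show False
      using spanning_tree_contr_no_detour[OF H_tree finite_Vle Vlt_subset_Vle root_Vlt e] by simp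
  qed
  have sorted: "sorted (map level (take (Suc (Suc k)) xs))"
    using IH(1) asc unfolding tk by (auto simp: sorted_append intro: order_trans)
  let ?U = "Vlt (level ?y)" and ?F = "H (level ?y) \<inter> ?P (Suc k)"
  have "{?y, ?x} \<in> ?F" using edge asc unfolding tk by (auto simp: max_def insert_commute)
  then have step: "(contr ?U ?y, contr ?U ?x) \<in> contr_link ?U ?F" by (rule contr_linkI)
  show ?case
  proof (cases "level ?x = level ?y")
    case True
    have "H (level ?y) \<inter> ?P k \<subseteq> ?F" unfolding tk by auto
    moreover have "level ?y = 0 \<or> (contr ?U ?x, None) \<in> (contr_link ?U (H (level ?y) \<inter> ?P k))\<^sup>*"
      using IH(2) True by simp
    ultimately have "level ?y = 0 \<or> (contr ?U ?x, None) \<in> (contr_link ?U ?F)\<^sup>*"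
      using contr_link_rtrancl_mono by metis
    then have "level ?y = 0 \<or> (contr ?U ?y, None) \<in> (contr_link ?U ?F)\<^sup>*"
      using converse_rtrancl_into_rtrancl[OF step] by blast
    then show ?thesis using sorted by blast
  next
    case False
    then have "contr ?U ?x = None" using asc V by (simp add: contr_def Vlt_eq)
    then show ?thesis using sorted step by auto
  qed
qed

lemma prim_path_sorted:
  assumes "is_path (\<Union>i. H i) xs" "hd xs = r"
  shows "sorted (map level xs)"
proof -
  have "length xs - 1 < length xs" using assms by (simp add: is_path_def)
  then show ?thesis using prim_path_levels[OF assms, of "length xs - 1"] by simp
qed

section \<open>The weight bound\<close>

lemma wt_H_le_walk_cost:
  assumes "xs \<noteq> []" "hd xs = r" "set xs = V"
  shows "wt d (H j) \<le> walk_cost (charge j) xs"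
proof -
  \<comment> \<open>A walk through all of \<open>V\<close> makes the invariant tree span
    \<open>Vle j\<close>, so it competes with \<open>H j\<close>; the leftover potential is
    dropped.\<close>
  have "insert r (Vlt j) \<union> (V \<inter> Vle j) = Vle j"
    using Vlt_subset_Vle by (auto simp: Vle_eq)
  then obtain F a where "spanning_tree_contr (Vle j) (Vlt j) F"
    "wt d F + potential j a (last xs) \<le> walk_cost (charge j) xs"
    using walk_level_tree[of xs j] assms by auto
  then show ?thesis
    using wt_H_le[of j F] potential_nonneg[of j a "last xs"] by linarith
qed

lemma sum_wt_H_le:
  assumes T: "spanning_tree_contr V (Vlt i) T"
  shows "(\<Sum>j\<in>{i..n}. wt d (H j)) \<le> 4 * wt d T"
proof -
  obtain xs where xs: "xs \<noteq> []" "hd xs = r" "set xs = V"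
    and cost: "walk_cost (\<lambda>x y. if y \<in> Vlt i then 0 else d x y) xs \<le> 2 * wt d T"
    using walk_of_spanning_tree[OF T _ root_Vlt] by (auto simp: Vlt_eq)
  \<comment> \<open>The same walk serves every level, so the sum over levels can be taken step by
    step.\<close>
  have "(\<Sum>j\<in>{i..n}. wt d (H j)) \<le> (\<Sum>j\<in>{i..n}. walk_cost (charge j) xs)"
    by (intro sum_mono wt_H_le_walk_cost xs)
  also have "\<dots> = walk_cost (\<lambda>x y. \<Sum>j\<in>{i..n}. charge j x y) xs"
    by (rule walk_cost_sum)
  also have "\<dots> \<le> walk_cost (\<lambda>x y. 2 * (if y \<in> Vlt i then 0 else d x y)) xs"
    by (intro walk_cost_mono sum_charge_le) (auto simp: xs)
  also have "\<dots> = 2 * walk_cost (\<lambda>x y. if y \<in> Vlt i then 0 else d x y) xs"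
    by (rule walk_cost_mult)
  finally show ?thesis using cost by linarith
qed

lemma mst_weight_attained:
  obtains T where "spanning_tree_contr V (Vlt i) T" "mst_weight d V (Vlt i) = wt d T"
proof -
  let ?S = "{F. spanning_tree_contr V (Vlt i) F}"
  have "?S \<subseteq> Pow (edges_on V)" by (auto simp: spanning_tree_contr_def)
  then have "finite ?S" using finite_edges_on[OF finite_V] finite_subset by blast
  moreover have "?S \<noteq> {}"
    using spanning_tree_contr_exists[OF finite_V _ root_Vlt] root by (auto simp: Vlt_eq)
  ultimately have "Min (wt d ` ?S) \<in> wt d ` ?S" by (intro Min_in) auto
  then show thesis using that unfolding mst_weight_def by auto
qed

end

theorem theorem2:
  fixes V :: "'a set" and d :: "'a \<Rightarrow> 'a \<Rightarrow> real" and r :: 'a and M :: real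
    and H :: "nat \<Rightarrow> 'a set set"
  assumes "finite_metric V d" and "r \<in> V" and "M > 0"
    and "\<And>i. is_mst d (lev_le V d r M i) (lev_lt V d r M i) (H i)"
  shows "spanning_tree_contr V {} (\<Union>i. H i)
       \<and> (\<forall>xs. is_path (\<Union>i. H i) xs \<and> hd xs = r \<and> is_leaf (\<Union>i. H i) (last xs)
              \<longrightarrow> sorted (map (level_of V d r M) xs))
       \<and> (\<forall>i n. (\<Sum>j\<in>{i..n}. wt d (H j)) \<le> 8 * mst_weight d V (lev_lt V d r M i))"
proof -
  interpret level_prim V d r M H
    by unfold_locales (use assms in auto)
  \<comment> \<open>The tail over all \<open>j\<close> from \<open>i\<close> on is bounded through
    its finite sections, uniformly in \<open>n\<close>.\<close>
  have "(\<Sum>j\<in>{i..n}. wt d (H j)) \<le> 8 * mst_weight d V (lev_lt V d r M i)" for i n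
  proof -
    obtain T where T: "spanning_tree_contr V (Vlt i) T" "mst_weight d V (Vlt i) = wt d T"
      by (rule mst_weight_attained)
    \<comment> \<open>Nonnegativity lets the factor 4 be relaxed to 8.\<close>
    moreover have "wt d T \<ge> 0"
      using T(1) wt_mono[of "{}" T] by (simp add: spanning_tree_contr_def wt_def)
    ultimately show ?thesis using sum_wt_H_le[OF T(1), of n] by simp
  qed
  then show ?thesis using prim_spanning_tree prim_path_sorted by blast
qed

end
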